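(* Let $\Gamma$ be a finite mixed graph with vertex set $V$ and underlying simplicial graph $\overline{\Gamma}$. With respect to the monoid generating set $S=V\sqcup V^{-1}$, the spherical growth of the twisted right-angled Artin group $G_\Gamma$ equals the spherical growth of the right-angled Artin group $G_{\overline{\Gamma}}$, and the geodesic growth of $G_\Gamma$ equals the geodesic growth of $G_{\overline{\Gamma}}$.
   Context: A mixed graph $\Gamma$ consists of a finite vertex set $V$, a set $E$ of two-element subsets of $V$ (edges), and a subset $D\subseteq E$ of directed edges, each $e\in D$ having an origin and a terminus, which are the two distinct endpoints of $e$. An undirected edge $\{a,b\}\in E\setminus D$ is written $[a,b]$; a directed edge with origin $a$ and terminus $b$ is written $[a,b\rangle$. The twisted right-angled Artin group (tRAAG) based on $\Gamma$ is $G_\Gamma=\langle V\mid ab=ba \text{ if }[a,b]\text{ is an undirected edge},\ aba=b\text{ if }[a,b\rangle\text{ is a directed edge}\rangle$. The underlying graph of $\Gamma$ is the simplicial graph $\overline{\Gamma}=(V,E)$ obtained by forgetting directions, and $G_{\overline\Gamma}=\langle V\mid ab=ba\text{ if }\{a,b\}\in E\rangle$ is the corresponding right-angled Artin group. For a group $G$ with monoid generating set $S$, $|g|$ is the length of a shortest word over $S$ representing $g$, and a word is geodesic if its length equals $|g|$ for the element $g$ it represents. The spherical growth is the function (equivalently, the generating series) counting, for each $n\ge 0$, the elements $g\in G$ with $|g|=n$; the geodesic growth counts, for each $n\ge 0$, the geodesic words over $S$ of length $n$. *)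

theory Defs
  imports "HOL-Algebra.Group"
begin

subsection \<open>Group presentations\<close>

text \<open>
  A letter \<open>Inl x\<close> stands for the generator \<open>x\<close> and \<open>Inr x\<close> for its formal inverse, so that
  \<open>letters X\<close> is the disjoint union of \<open>X\<close> and its set of formal inverses.
\<close>

type_synonym 'a word = "('a + 'a) list"

definition letters :: "'a set \<Rightarrow> ('a + 'a) set" where
  "letters X = X <+> X"

definition inv_letter :: "'a + 'a \<Rightarrow> 'a + 'a" where
  "inv_letter = case_sum Inr Inl"

text \<open>
  The congruence on words generated by free cancellation and the relations \<open>u = v\<close> for
  \<open>(u, v) \<in> R\<close>; its quotient is the group presented by generators \<open>X\<close> and relations \<open>R\<close>.
\<close>

inductive_set pres_cong :: "'a set \<Rightarrow> ('a word \<times> 'a word) set \<Rightarrow> ('a word \<times> 'a word) set"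
  for X :: "'a set" and R :: "('a word \<times> 'a word) set" where
  pres_cong_refl: "w \<in> lists (letters X) \<Longrightarrow> (w, w) \<in> pres_cong X R"
| pres_cong_sym: "(u, v) \<in> pres_cong X R \<Longrightarrow> (v, u) \<in> pres_cong X R"
| pres_cong_trans: "(u, v) \<in> pres_cong X R \<Longrightarrow> (v, w) \<in> pres_cong X R \<Longrightarrow> (u, w) \<in> pres_cong X R"
| pres_cong_app: "(u, u') \<in> pres_cong X R \<Longrightarrow> (v, v') \<in> pres_cong X R \<Longrightarrow> (u @ v, u' @ v') \<in> pres_cong X R"
| pres_cong_cancel: "s \<in> letters X \<Longrightarrow> ([s, inv_letter s], []) \<in> pres_cong X R"
| pres_cong_rel: "(u, v) \<in> R \<Longrightarrow> u \<in> lists (letters X) \<Longrightarrow> v \<in> lists (letters X) \<Longrightarrow> (u, v) \<in> pres_cong X R"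

definition presented_group :: "'a set \<Rightarrow> ('a word \<times> 'a word) set \<Rightarrow> 'a word set monoid" where
  "presented_group X R =
    \<lparr>carrier = lists (letters X) // pres_cong X R,
     mult = (\<lambda>A B. \<Union>u\<in>A. \<Union>v\<in>B. pres_cong X R `` {u @ v}),
     one = pres_cong X R `` {[]}\<rparr>"

definition letter_class :: "'a set \<Rightarrow> ('a word \<times> 'a word) set \<Rightarrow> 'a + 'a \<Rightarrow> 'a word set" where
  "letter_class X R s = pres_cong X R `` {[s]}"

lemma inv_letter_in [simp]: "inv_letter s \<in> letters X \<longleftrightarrow> s \<in> letters X"
  by (cases s) (auto simp: inv_letter_def letters_def)

lemma inv_letter_inv [simp]: "inv_letter (inv_letter s) = s"
  by (cases s) (auto simp: inv_letter_def)

lemma pres_cong_words: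
  "(u, v) \<in> pres_cong X R \<Longrightarrow> u \<in> lists (letters X) \<and> v \<in> lists (letters X)"
  by (induction rule: pres_cong.induct) auto

lemma equiv_pres_cong: "equiv (lists (letters X)) (pres_cong X R)"
  by (intro equivI refl_onI symI transI)
    (auto intro: pres_cong_refl pres_cong_sym pres_cong_trans dest: pres_cong_words)

lemma pres_class_eq_iff:
  assumes "u \<in> lists (letters X)" "v \<in> lists (letters X)"
  shows "pres_cong X R `` {u} = pres_cong X R `` {v} \<longleftrightarrow> (u, v) \<in> pres_cong X R"
  using equiv_pres_cong assms by (metis equiv_class_eq_iff)

lemma carrier_presented_group:
  "carrier (presented_group X R) = lists (letters X) // pres_cong X R"
  by (simp add: presented_group_def)

lemma carrier_presented_groupE:
  assumes "x \<in> carrier (presented_group X R)"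
  obtains u where "u \<in> lists (letters X)" "x = pres_cong X R `` {u}"
  using assms unfolding carrier_presented_group by (rule quotientE)

lemma one_presented_group: "\<one>\<^bsub>presented_group X R\<^esub> = pres_cong X R `` {[]}"
  by (simp add: presented_group_def)

lemma mult_presented_group:
  assumes "u \<in> lists (letters X)" "v \<in> lists (letters X)"
  shows "pres_cong X R `` {u} \<otimes>\<^bsub>presented_group X R\<^esub> pres_cong X R `` {v}
       = pres_cong X R `` {u @ v}"
proof -
  have *: "pres_cong X R `` {u' @ v'} = pres_cong X R `` {u @ v}"
    if "(u, u') \<in> pres_cong X R" "(v, v') \<in> pres_cong X R" for u' v'
    by (metis equiv_class_eq[OF equiv_pres_cong] pres_cong_app that)
  have "(u, u) \<in> pres_cong X R" "(v, v) \<in> pres_cong X R"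
    using assms by (auto intro: pres_cong_refl)
  then have "(\<Union>u'\<in>pres_cong X R `` {u}. \<Union>v'\<in>pres_cong X R `` {v}. pres_cong X R `` {u' @ v'})
      = (\<Union>u'\<in>pres_cong X R `` {u}. \<Union>v'\<in>pres_cong X R `` {v}. pres_cong X R `` {u @ v})"
    by (intro SUP_cong refl *) simp_all
  also have "\<dots> = pres_cong X R `` {u @ v}"
    using \<open>(u, u) \<in> _\<close> \<open>(v, v) \<in> _\<close> by blast
  finally show ?thesis
    by (simp only: presented_group_def monoid.simps)
qed

lemma pres_cong_inverse:
  assumes "w \<in> lists (letters X)"
  shows "(rev (map inv_letter w) @ w, []) \<in> pres_cong X R"
  using assms
proof (induction w)
  case Nil
  then show ?case by (auto intro: pres_cong_refl)
next
  case (Cons s w)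
  let ?w' = "rev (map inv_letter w)"
  have w: "s \<in> letters X" "w \<in> lists (letters X)" "?w' \<in> lists (letters X)"
    using Cons.hyps by auto
  have "([inv_letter s, s], []) \<in> pres_cong X R"
    using pres_cong_cancel[of "inv_letter s" X R] w by simp
  then have "(?w' @ ([inv_letter s, s] @ w), ?w' @ ([] @ w)) \<in> pres_cong X R"
    using w by (intro pres_cong_app pres_cong_refl)
  then show ?case
    using pres_cong_trans[OF _ Cons.IH] by simp
qed

theorem group_presented_group: "group (presented_group X R)"
proof (rule groupI)
  let ?G = "presented_group X R"
  fix x y z
  show "\<one>\<^bsub>?G\<^esub> \<in> carrier ?G"
    by (simp add: one_presented_group carrier_presented_group quotientI)
  assume "x \<in> carrier ?G"
  then obtain u where u: "u \<in> lists (letters X)" "x = pres_cong X R `` {u}"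
    by (rule carrier_presented_groupE)
  show "\<one>\<^bsub>?G\<^esub> \<otimes>\<^bsub>?G\<^esub> x = x"
    using u mult_presented_group[of "[]" X u R] by (simp add: one_presented_group)
  let ?u' = "rev (map inv_letter u)"
  have u': "?u' \<in> lists (letters X)"
    using u by auto
  have "pres_cong X R `` {?u'} \<otimes>\<^bsub>?G\<^esub> x = \<one>\<^bsub>?G\<^esub>"
    unfolding u(2) mult_presented_group[OF u' u(1)] one_presented_group
    by (rule equiv_class_eq[OF equiv_pres_cong pres_cong_inverse[OF u(1)]])
  moreover have "pres_cong X R `` {?u'} \<in> carrier ?G"
    unfolding carrier_presented_group using u' by (rule quotientI)
  ultimately show "\<exists>y\<in>carrier ?G. y \<otimes>\<^bsub>?G\<^esub> x = \<one>\<^bsub>?G\<^esub>"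
    by blast
  assume "y \<in> carrier ?G"
  then obtain v where v: "v \<in> lists (letters X)" "y = pres_cong X R `` {v}"
    by (rule carrier_presented_groupE)
  have uv: "u @ v \<in> lists (letters X)"
    using u v by auto
  show "x \<otimes>\<^bsub>?G\<^esub> y \<in> carrier ?G"
    unfolding u(2) v(2) mult_presented_group[OF u(1) v(1)] carrier_presented_group
    using uv by (rule quotientI)
  assume "z \<in> carrier ?G"
  then obtain w where w: "w \<in> lists (letters X)" "z = pres_cong X R `` {w}"
    by (rule carrier_presented_groupE)
  have vw: "v @ w \<in> lists (letters X)"
    using v w by auto
  show "x \<otimes>\<^bsub>?G\<^esub> y \<otimes>\<^bsub>?G\<^esub> z = x \<otimes>\<^bsub>?G\<^esub> (y \<otimes>\<^bsub>?G\<^esub> z)"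
    unfolding u(2) v(2) w(2)
    by (simp only: mult_presented_group[OF u(1) v(1)] mult_presented_group[OF v(1) w(1)]
        mult_presented_group[OF uv w(1)] mult_presented_group[OF u(1) vw] append_assoc)
qed


subsection \<open>Growth functions\<close>

text \<open>
  The alphabet \<open>S\<close> comes with an evaluation map \<open>\<iota>\<close> into the group whose image generates it as a
  monoid; for a generating set inside the group, \<open>\<iota>\<close> is the identity. Without generation,
  \<open>word_length\<close> is unspecified outside the submonoid generated by the image.
\<close>

definition eval_word :: "('g, 'm) monoid_scheme \<Rightarrow> ('s \<Rightarrow> 'g) \<Rightarrow> 's list \<Rightarrow> 'g" where
  "eval_word G \<iota> w = foldr (\<otimes>\<^bsub>G\<^esub>) (map \<iota> w) \<one>\<^bsub>G\<^esub>"

definition word_length :: "('g, 'm) monoid_scheme \<Rightarrow> 's set \<Rightarrow> ('s \<Rightarrow> 'g) \<Rightarrow> 'g \<Rightarrow> nat" where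
  "word_length G S \<iota> g = (LEAST n. \<exists>w\<in>lists S. eval_word G \<iota> w = g \<and> length w = n)"

definition geodesic :: "('g, 'm) monoid_scheme \<Rightarrow> 's set \<Rightarrow> ('s \<Rightarrow> 'g) \<Rightarrow> 's list \<Rightarrow> bool" where
  "geodesic G S \<iota> w \<longleftrightarrow> w \<in> lists S \<and> length w = word_length G S \<iota> (eval_word G \<iota> w)"

definition spherical_growth :: "('g, 'm) monoid_scheme \<Rightarrow> 's set \<Rightarrow> ('s \<Rightarrow> 'g) \<Rightarrow> nat \<Rightarrow> nat" where
  "spherical_growth G S \<iota> n = card {g \<in> carrier G. word_length G S \<iota> g = n}"

definition geodesic_growth :: "('g, 'm) monoid_scheme \<Rightarrow> 's set \<Rightarrow> ('s \<Rightarrow> 'g) \<Rightarrow> nat \<Rightarrow> nat" where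
  "geodesic_growth G S \<iota> n = card {w. geodesic G S \<iota> w \<and> length w = n}"

lemma eval_word_presented_group:
  assumes "w \<in> lists (letters X)"
  shows "eval_word (presented_group X R) (letter_class X R) w = pres_cong X R `` {w}"
  using assms
proof (induction w)
  case Nil
  then show ?case by (simp add: eval_word_def one_presented_group)
next
  case (Cons s w)
  then show ?case
    using mult_presented_group[of "[s]" X w R] by (simp add: eval_word_def letter_class_def)
qed

lemma presented_group_generated:
  "eval_word (presented_group X R) (letter_class X R) ` lists (letters X)
     = carrier (presented_group X R)"
proof -
  have "eval_word (presented_group X R) (letter_class X R) ` lists (letters X)
      = (\<lambda>w. pres_cong X R `` {w}) ` lists (letters X)"
    by (rule image_cong[OF refl eval_word_presented_group])
  then show ?thesis
    by (simp only: carrier_presented_group quotient_def UNION_singleton_eq_range)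
qed

lemma letter_class_Inr:
  assumes "x \<in> X"
  shows "letter_class X R (Inr x) = inv\<^bsub>presented_group X R\<^esub> letter_class X R (Inl x)"
proof -
  have l: "[Inl x] \<in> lists (letters X)" "[Inr x] \<in> lists (letters X)"
    using assms by (auto simp: letters_def)
  have "([Inr x, Inl x], []) \<in> pres_cong X R"
    using pres_cong_cancel[of "Inr x" X R] assms by (auto simp: letters_def inv_letter_def)
  then have "letter_class X R (Inr x) \<otimes>\<^bsub>presented_group X R\<^esub> letter_class X R (Inl x)
      = \<one>\<^bsub>presented_group X R\<^esub>"
    using l by (simp add: letter_class_def mult_presented_group one_presented_group
        equiv_class_eq[OF equiv_pres_cong])
  then show ?thesis
    using l by (intro group.inv_equality[OF group_presented_group, symmetric])
      (simp_all add: letter_class_def carrier_presented_group quotientI)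
qed


subsection \<open>Mixed graphs and twisted right-angled Artin groups\<close>

record 'a sgraph =
  verts :: "'a set"
  edges :: "'a set set"

record 'a mixed_graph = "'a sgraph" +
  dir_edges :: "'a set set"
  origin :: "'a set \<Rightarrow> 'a"
  terminus :: "'a set \<Rightarrow> 'a"

text \<open>The values of \<open>origin\<close> and \<open>terminus\<close> outside \<open>dir_edges\<close> are irrelevant.\<close>

definition is_mixed_graph :: "'a mixed_graph \<Rightarrow> bool" where
  "is_mixed_graph \<Gamma> \<longleftrightarrow>
     finite (verts \<Gamma>) \<and>
     (\<forall>e\<in>edges \<Gamma>. e \<subseteq> verts \<Gamma> \<and> card e = 2) \<and>
     dir_edges \<Gamma> \<subseteq> edges \<Gamma> \<and>
     (\<forall>e\<in>dir_edges \<Gamma>. origin \<Gamma> e \<noteq> terminus \<Gamma> e \<and> e = {origin \<Gamma> e, terminus \<Gamma> e})"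

definition underlying_graph :: "'a mixed_graph \<Rightarrow> 'a sgraph" where
  "underlying_graph \<Gamma> = \<lparr>verts = verts \<Gamma>, edges = edges \<Gamma>\<rparr>"

definition raag_rels :: "'a sgraph \<Rightarrow> ('a word \<times> 'a word) set" where
  "raag_rels \<Delta> = {([Inl a, Inl b], [Inl b, Inl a]) | a b. {a, b} \<in> edges \<Delta>}"

definition raag :: "'a sgraph \<Rightarrow> 'a word set monoid" where
  "raag \<Delta> = presented_group (verts \<Delta>) (raag_rels \<Delta>)"

definition traag_rels :: "'a mixed_graph \<Rightarrow> ('a word \<times> 'a word) set" where
  "traag_rels \<Gamma> =
     {([Inl a, Inl b], [Inl b, Inl a]) | a b. {a, b} \<in> edges \<Gamma> - dir_edges \<Gamma>} \<union>
     {([Inl a, Inl b, Inl a], [Inl b]) | a b.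
        {a, b} \<in> dir_edges \<Gamma> \<and> origin \<Gamma> {a, b} = a \<and> terminus \<Gamma> {a, b} = b}"

definition traag :: "'a mixed_graph \<Rightarrow> 'a word set monoid" where
  "traag \<Gamma> = presented_group (verts \<Gamma>) (traag_rels \<Gamma>)"

definition raag_letter :: "'a sgraph \<Rightarrow> 'a + 'a \<Rightarrow> 'a word set" where
  "raag_letter \<Delta> = letter_class (verts \<Delta>) (raag_rels \<Delta>)"

definition traag_letter :: "'a mixed_graph \<Rightarrow> 'a + 'a \<Rightarrow> 'a word set" where
  "traag_letter \<Gamma> = letter_class (verts \<Gamma>) (traag_rels \<Gamma>)"

end

theory Submission
  imports Defs
begin

text \<open>
  The relation \<open>aba = b\<close> of a directed edge says \<open>ab = ba\<inverse>\<close>: the letters \<open>a\<close> and \<open>b\<close> may be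
  exchanged at the cost of inverting \<open>a\<close>. So a word over \<open>V \<squnion> V\<inverse>\<close> is rewritten in the twisted group
  exactly as in the right-angled Artin group, except for the exponents of its letters, and these can
  be corrected by bookkeeping. Let \<open>\<phi>\<close> invert a letter \<open>a\<^sup>\<plusminus>\<^sup>1\<close> of a word whenever an odd number of
  the letters to its left are of the form \<open>b\<^sup>\<plusminus>\<^sup>1\<close> for a directed edge from \<open>a\<close> to \<open>b\<close>. Moving \<open>a\<close> to
  the other side of \<open>b\<close> changes this parity by one, which makes up for the inversion of \<open>a\<close>; and two
  mutually inverse neighbours always see the same parity, so that \<open>\<phi>\<close> respects free cancellation.

  Since \<open>\<phi>\<close> keeps the vertex below every letter, it keeps all parities, hence it is an involution
  on words, and it preserves length. The lemma \<open>twist_pres_cong\<close> reduces its compatibility with two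
  presentations to the defining relations; applied in both directions it gives that two words are
  equal in \<open>G\<^sub>\<Gamma>\<close> if and only if their images are equal in the right-angled Artin group. A
  length-preserving bijection between words with this property matches geodesics with geodesics and
  spheres with spheres (\<open>growth_eq_of_word_bijection\<close>).
\<close>

section \<open>Growth under a length-preserving bijection of words\<close>

lemma growth_eq_of_word_bijection:
  fixes f :: "'s list \<Rightarrow> 't list"
  assumes bij: "bij_betw f (lists S) (lists T)"
    and len: "\<And>w. w \<in> lists S \<Longrightarrow> length (f w) = length w"
    and eq: "\<And>u v. u \<in> lists S \<Longrightarrow> v \<in> lists S \<Longrightarrow>
      eval_word H \<kappa> (f u) = eval_word H \<kappa> (f v) \<longleftrightarrow> eval_word G \<iota> u = eval_word G \<iota> v"
    and genG: "eval_word G \<iota> ` lists S = carrier G"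
    and genH: "eval_word H \<kappa> ` lists T = carrier H"
  shows "spherical_growth G S \<iota> = spherical_growth H T \<kappa>"
    and "geodesic_growth G S \<iota> = geodesic_growth H T \<kappa>"
proof -
  have f_in: "f w \<in> lists T" if "w \<in> lists S" for w
    by (rule bspec[OF bij_betwE[OF bij] that])
  have f_surj: "\<exists>v \<in> lists S. w = f v" if "w \<in> lists T" for w
    using that unfolding bij_betw_imp_surj_on[OF bij, symmetric] by (simp only: image_iff)
  have evalG: "\<exists>w \<in> lists S. g = eval_word G \<iota> w" if "g \<in> carrier G" for g
    using that unfolding genG[symmetric] by (simp only: image_iff)
  have evalH: "\<exists>w \<in> lists S. h = eval_word H \<kappa> (f w)" if "h \<in> carrier H" for h
    using that unfolding genH[symmetric] bij_betw_imp_surj_on[OF bij, symmetric] image_image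
    by (simp only: image_iff)
  have eval_in_G: "eval_word G \<iota> w \<in> carrier G" if "w \<in> lists S" for w
    unfolding genG[symmetric] using that by (rule imageI)
  have eval_in_H: "eval_word H \<kappa> (f w) \<in> carrier H" if "w \<in> lists S" for w
    unfolding genH[symmetric] using f_in[OF that] by (rule imageI)
  have wl: "word_length H T \<kappa> (eval_word H \<kappa> (f w)) = word_length G S \<iota> (eval_word G \<iota> w)"
    if w: "w \<in> lists S" for w
  proof -
    have "(\<exists>v\<in>lists T. eval_word H \<kappa> v = eval_word H \<kappa> (f w) \<and> length v = n)
      \<longleftrightarrow> (\<exists>v\<in>lists S. eval_word G \<iota> v = eval_word G \<iota> w \<and> length v = n)" (is "?l \<longleftrightarrow> ?r") for n
    proof -
      have "?l \<longleftrightarrow> (\<exists>v\<in>lists S. eval_word H \<kappa> (f v) = eval_word H \<kappa> (f w) \<and> length (f v) = n)"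
        by (simp only: bij_betw_imp_surj_on[OF bij, symmetric] bex_simps)
      also have "\<dots> \<longleftrightarrow> ?r"
        by (rule bex_cong[OF refl]) (simp only: eq[OF _ w] len)
      finally show ?thesis .
    qed
    then show ?thesis
      unfolding word_length_def by simp
  qed
  show "geodesic_growth G S \<iota> = geodesic_growth H T \<kappa>"
  proof
    fix n
    have "bij_betw f {w. geodesic G S \<iota> w \<and> length w = n} {w. geodesic H T \<kappa> w \<and> length w = n}"
    proof (rule bij_betw_imageI)
      show "inj_on f {w. geodesic G S \<iota> w \<and> length w = n}"
        using bij_betw_imp_inj_on[OF bij] by (rule inj_on_subset) (auto simp: geodesic_def)
      have in_lists: "w \<in> lists S" if "geodesic G S \<iota> w" for w
        using that by (simp add: geodesic_def)
      have geo: "geodesic H T \<kappa> (f w) \<longleftrightarrow> geodesic G S \<iota> w" if "w \<in> lists S" for w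
        unfolding geodesic_def using that f_in[OF that] len[OF that] wl[OF that]
        by (simp del: in_lists_conv_set)
      show "f ` {w. geodesic G S \<iota> w \<and> length w = n} = {w. geodesic H T \<kappa> w \<and> length w = n}"
      proof (intro equalityI subsetI)
        fix w assume "w \<in> f ` {w. geodesic G S \<iota> w \<and> length w = n}"
        then obtain v where "geodesic G S \<iota> v" "length v = n" "w = f v"
          by blast
        then show "w \<in> {w. geodesic H T \<kappa> w \<and> length w = n}"
          using geo[OF in_lists] len[OF in_lists] by simp
      next
        fix w assume w: "w \<in> {w. geodesic H T \<kappa> w \<and> length w = n}"
        then have "w \<in> lists T"
          by (simp add: geodesic_def)
        then obtain v where "v \<in> lists S" "w = f v"
          using f_surj by blast
        then show "w \<in> f ` {w. geodesic G S \<iota> w \<and> length w = n}"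
          using w geo[of v] len[of v] by simp
      qed
    qed
    then show "geodesic_growth G S \<iota> n = geodesic_growth H T \<kappa> n"
      unfolding geodesic_growth_def by (rule bij_betw_same_card)
  qed
  \<comment> \<open>The induced map on group elements: evaluate the image of any word for the element.\<close>
  define F where "F = (\<lambda>g. eval_word H \<kappa> (f (inv_into (lists S) (eval_word G \<iota>) g)))"
  have F: "F (eval_word G \<iota> w) = eval_word H \<kappa> (f w)" if w: "w \<in> lists S" for w
  proof -
    let ?g = "eval_word G \<iota> w"
    have "?g \<in> eval_word G \<iota> ` lists S"
      using w by (rule imageI)
    then have "inv_into (lists S) (eval_word G \<iota>) ?g \<in> lists S"
      "eval_word G \<iota> (inv_into (lists S) (eval_word G \<iota>) ?g) = ?g"
      by (rule inv_into_into, rule f_inv_into_f)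
    then show ?thesis
      unfolding F_def by (simp only: eq[OF _ w])
  qed
  show "spherical_growth G S \<iota> = spherical_growth H T \<kappa>"
  proof
    fix n
    have "bij_betw F {g \<in> carrier G. word_length G S \<iota> g = n}
        {g \<in> carrier H. word_length H T \<kappa> g = n}"
    proof (rule bij_betw_imageI)
      show "inj_on F {g \<in> carrier G. word_length G S \<iota> g = n}"
      proof (rule inj_onI)
        fix g h
        assume "g \<in> {g \<in> carrier G. word_length G S \<iota> g = n}"
          "h \<in> {g \<in> carrier G. word_length G S \<iota> g = n}" and gh: "F g = F h"
        then have "g \<in> carrier G" "h \<in> carrier G"
          by simp_all
        then obtain u v where u: "u \<in> lists S" "g = eval_word G \<iota> u"
          and v: "v \<in> lists S" "h = eval_word G \<iota> v"
          using evalG by meson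
        show "g = h"
          using gh unfolding u(2) v(2) F[OF u(1)] F[OF v(1)] eq[OF u(1) v(1)] .
      qed
      show "F ` {g \<in> carrier G. word_length G S \<iota> g = n}
          = {g \<in> carrier H. word_length H T \<kappa> g = n}"
      proof (intro equalityI subsetI)
        fix h assume "h \<in> F ` {g \<in> carrier G. word_length G S \<iota> g = n}"
        then obtain g where g: "g \<in> carrier G" "word_length G S \<iota> g = n" "h = F g"
          by blast
        then obtain w where w: "w \<in> lists S" "g = eval_word G \<iota> w"
          using evalG by meson
        show "h \<in> {g \<in> carrier H. word_length H T \<kappa> g = n}"
          using g eval_in_H[OF w(1)] wl[OF w(1)] F[OF w(1)] w(2) by simp
      next
        fix h assume h: "h \<in> {g \<in> carrier H. word_length H T \<kappa> g = n}"
        then have "h \<in> carrier H"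
          by simp
        then obtain w where w: "w \<in> lists S" "h = eval_word H \<kappa> (f w)"
          using evalH by meson
        have "eval_word G \<iota> w \<in> {g \<in> carrier G. word_length G S \<iota> g = n}"
          using h eval_in_G[OF w(1)] wl[OF w(1)] w(2) by simp
        then show "h \<in> F ` {g \<in> carrier G. word_length G S \<iota> g = n}"
          unfolding w(2) F[OF w(1), symmetric] by (rule imageI)
      qed
    qed
    then show "spherical_growth G S \<iota> n = spherical_growth H T \<kappa> n"
      unfolding spherical_growth_def by (rule bij_betw_same_card)
  qed
qed

section \<open>Exchanging letters in a presented group\<close>

lemma pres_cong_context:
  assumes "(u, v) \<in> pres_cong X R" "x \<in> lists (letters X)" "y \<in> lists (letters X)"
  shows "(x @ u @ y, x @ v @ y) \<in> pres_cong X R"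
  using assms by (intro pres_cong_app pres_cong_refl)

lemma pres_cong_cancel_context:
  assumes "s \<in> letters X" "x \<in> lists (letters X)" "y \<in> lists (letters X)"
  shows "(x @ [s, inv_letter s] @ y, x @ y) \<in> pres_cong X R"
    and "(x @ [inv_letter s, s] @ y, x @ y) \<in> pres_cong X R"
  using pres_cong_context[OF pres_cong_cancel, of s X x y R]
    pres_cong_context[OF pres_cong_cancel, of "inv_letter s" X x y R] assms by simp_all

text \<open>Read \<open>st = ts'\<close> as \<open>t\<inverse>st = s'\<close>; this lemma inverts both sides of that conjugation.\<close>

lemma exchange_inv_moved:
  assumes L: "s \<in> letters X" "t \<in> letters X" "s' \<in> letters X"
    and ex: "([s, t], [t, s']) \<in> pres_cong X R"
  shows "([inv_letter s, t], [t, inv_letter s']) \<in> pres_cong X R"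
proof -
  have "([inv_letter s, t], [inv_letter s, t, s', inv_letter s']) \<in> pres_cong X R"
    using pres_cong_sym[OF pres_cong_cancel_context(1)[of s' X "[inv_letter s, t]" "[]" R]] L by simp
  moreover have "([inv_letter s, t, s', inv_letter s'], [inv_letter s, s, t, inv_letter s'])
      \<in> pres_cong X R"
    using pres_cong_context[OF pres_cong_sym[OF ex], of "[inv_letter s]" "[inv_letter s']"] L by simp
  moreover have "([inv_letter s, s, t, inv_letter s'], [t, inv_letter s']) \<in> pres_cong X R"
    using pres_cong_cancel_context(2)[of s X "[]" "[t, inv_letter s']" R] L by simp
  ultimately show ?thesis
    by (meson pres_cong_trans)
qed

text \<open>If conjugation by \<open>t\<close> takes \<open>s\<close> to \<open>s'\<close>, then conjugation by \<open>t\<inverse>\<close> takes \<open>s'\<close> to \<open>s\<close>.\<close>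

lemma exchange_inv_passed:
  assumes L: "s \<in> letters X" "t \<in> letters X" "s' \<in> letters X"
    and ex: "([s, t], [t, s']) \<in> pres_cong X R"
  shows "([s', inv_letter t], [inv_letter t, s]) \<in> pres_cong X R"
proof -
  have "([s', inv_letter t], [inv_letter t, t, s', inv_letter t]) \<in> pres_cong X R"
    using pres_cong_sym[OF pres_cong_cancel_context(2)[of t X "[]" "[s', inv_letter t]" R]] L by simp
  moreover have "([inv_letter t, t, s', inv_letter t], [inv_letter t, s, t, inv_letter t])
      \<in> pres_cong X R"
    using pres_cong_context[OF pres_cong_sym[OF ex], of "[inv_letter t]" "[inv_letter t]"] L by simp
  moreover have "([inv_letter t, s, t, inv_letter t], [inv_letter t, s]) \<in> pres_cong X R"
    using pres_cong_cancel_context(1)[of t X "[inv_letter t, s]" "[]" R] L by simp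
  ultimately show ?thesis
    by (meson pres_cong_trans)
qed

definition invert_if :: "bool \<Rightarrow> 'a + 'a \<Rightarrow> 'a + 'a" where
  "invert_if p s = (if p then inv_letter s else s)"

lemma invert_if_in [simp]: "invert_if p s \<in> letters X \<longleftrightarrow> s \<in> letters X"
  by (simp add: invert_if_def)

lemma invert_if_invert_if [simp]: "invert_if p (invert_if q s) = invert_if (p \<noteq> q) s"
  by (auto simp: invert_if_def)

lemma inv_invert_if: "inv_letter (invert_if p s) = invert_if (\<not> p) s"
  by (auto simp: invert_if_def)

text \<open>
  Conjugation by \<open>t\<close> acts on \<open>{s, s\<inverse>}\<close> as the swap (\<open>d\<close> true) or as the identity (\<open>d\<close> false). Either
  map is its own inverse, so \<open>t\<inverse>\<close> acts in the same way, and the exchange has the same form for all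
  four choices of exponents.
\<close>

lemma exchange_all_signs:
  assumes L: "s \<in> letters X" "t \<in> letters X"
    and ex: "([s, t], [t, invert_if d s]) \<in> pres_cong X R"
  shows "([invert_if p s, invert_if q t], [invert_if q t, invert_if (p \<noteq> d) s]) \<in> pres_cong X R"
proof -
  have moved: "([invert_if p s, t], [t, invert_if (p \<noteq> d) s]) \<in> pres_cong X R" for p
    using exchange_inv_moved[OF _ _ _ ex] ex L by (cases p) (simp_all add: invert_if_def split: if_splits)
  have "([invert_if p s, inv_letter t], [inv_letter t, invert_if (p \<noteq> d) s]) \<in> pres_cong X R"
    using exchange_inv_passed[OF _ _ _ moved[of "p \<noteq> d"]] L by (cases d) simp_all
  then show ?thesis
    using moved by (cases q) (simp_all add: invert_if_def)
qed

section \<open>Twisting the exponents of a word\<close>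

definition letter_vertex :: "'a + 'a \<Rightarrow> 'a" where
  "letter_vertex = case_sum id id"

lemma letter_vertex_simps [simp]:
  "letter_vertex (Inl a) = a" "letter_vertex (Inr a) = a"
  "letter_vertex (inv_letter s) = letter_vertex s"
  "letter_vertex (invert_if p s) = letter_vertex s"
  by (cases s; simp add: letter_vertex_def inv_letter_def invert_if_def)+

text \<open>
  Here \<open>d a b\<close> means that passing a letter over \<open>b\<close> inverts the letters over \<open>a\<close>, and \<open>p a\<close> is the
  parity of the letters read so far that do so. Carrying \<open>p\<close> as an argument makes \<open>twist\<close> a
  transducer, so that it can be evaluated on a subword without knowing what precedes it.
\<close>

fun parity_after :: "('a \<Rightarrow> 'a \<Rightarrow> bool) \<Rightarrow> ('a \<Rightarrow> bool) \<Rightarrow> 'a word \<Rightarrow> 'a \<Rightarrow> bool" where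
  "parity_after d p [] = p"
| "parity_after d p (s # w) = parity_after d (\<lambda>a. p a \<noteq> d a (letter_vertex s)) w"

fun twist :: "('a \<Rightarrow> 'a \<Rightarrow> bool) \<Rightarrow> ('a \<Rightarrow> bool) \<Rightarrow> 'a word \<Rightarrow> 'a word" where
  "twist d p [] = []"
| "twist d p (s # w) =
     invert_if (p (letter_vertex s)) s # twist d (\<lambda>a. p a \<noteq> d a (letter_vertex s)) w"

lemma parity_after_append: "parity_after d p (u @ v) = parity_after d (parity_after d p u) v"
  by (induction u arbitrary: p) simp_all

lemma twist_append: "twist d p (u @ v) = twist d p u @ twist d (parity_after d p u) v"
  by (induction u arbitrary: p) simp_all

lemma length_twist [simp]: "length (twist d p w) = length w"
  by (induction w arbitrary: p) simp_all

lemma twist_in_lists: "w \<in> lists (letters X) \<Longrightarrow> twist d p w \<in> lists (letters X)"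
  by (induction w arbitrary: p) auto

lemma twist_twist [simp]: "twist d p (twist d p w) = w"
  by (induction w arbitrary: p) (simp_all add: invert_if_def[of False])

text \<open>
  Compatibility with a product needs that congruent left factors leave the same parities behind, so
  this is carried through the induction. Cancellation is preserved because a letter never inverts
  letters over its own vertex.
\<close>

lemma twist_pres_cong:
  assumes irrefl: "\<And>a. \<not> d a a"
    and rel: "\<And>u v p. (u, v) \<in> R \<Longrightarrow> u \<in> lists (letters X) \<Longrightarrow> v \<in> lists (letters X) \<Longrightarrow>
      (twist d p u, twist d p v) \<in> pres_cong X R' \<and> parity_after d p u = parity_after d p v"
    and "(u, v) \<in> pres_cong X R"
  shows "(twist d p u, twist d p v) \<in> pres_cong X R' \<and> parity_after d p u = parity_after d p v"
  using assms(3)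
proof (induction arbitrary: p)
  case (pres_cong_refl w)
  then show ?case
    by (intro conjI pres_cong.pres_cong_refl twist_in_lists refl)
next
  case (pres_cong_sym u v)
  show ?case
    using pres_cong_sym.IH[of p] by (simp add: pres_cong.pres_cong_sym)
next
  case (pres_cong_trans u v w)
  show ?case
    using pres_cong_trans.IH(1)[of p] pres_cong_trans.IH(2)[of p]
    by (auto intro: pres_cong.pres_cong_trans)
next
  case (pres_cong_app u u' v v')
  show ?case
    using pres_cong_app.IH(1)[of p] pres_cong_app.IH(2)[of "parity_after d p u"]
    by (simp add: twist_append parity_after_append pres_cong.pres_cong_app)
next
  case (pres_cong_cancel s)
  let ?t = "invert_if (p (letter_vertex s)) s"
  have "twist d p [s, inv_letter s] = [?t, inv_letter ?t]"
    by (simp add: irrefl invert_if_def)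
  moreover have "([?t, inv_letter ?t], []) \<in> pres_cong X R'"
    using pres_cong_cancel by (intro pres_cong.pres_cong_cancel) simp
  moreover have "parity_after d p [s, inv_letter s] = parity_after d p []"
    by (auto simp: fun_eq_iff)
  ultimately show ?case
    by (simp only: twist.simps(1))
next
  case (pres_cong_rel u v)
  then show ?case
    by (rule rel)
qed

section \<open>Mixed graphs\<close>

definition inverted_by :: "'a mixed_graph \<Rightarrow> 'a \<Rightarrow> 'a \<Rightarrow> bool" where
  "inverted_by \<Gamma> a b \<longleftrightarrow>
     {a, b} \<in> dir_edges \<Gamma> \<and> origin \<Gamma> {a, b} = a \<and> terminus \<Gamma> {a, b} = b"

lemma inverted_by_distinct:
  assumes \<Gamma>: "is_mixed_graph \<Gamma>" and ab: "inverted_by \<Gamma> a b"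
  shows "a \<noteq> b"
proof -
  have "\<forall>e\<in>dir_edges \<Gamma>. origin \<Gamma> e \<noteq> terminus \<Gamma> e"
    using \<Gamma> unfolding is_mixed_graph_def by blast
  then have "origin \<Gamma> {a, b} \<noteq> terminus \<Gamma> {a, b}"
    using ab unfolding inverted_by_def by (elim conjE) (rule bspec)
  moreover have "origin \<Gamma> {a, b} = a" "terminus \<Gamma> {a, b} = b"
    using ab by (simp_all add: inverted_by_def)
  ultimately show ?thesis
    by argo
qed

lemma inverted_by_irrefl: "is_mixed_graph \<Gamma> \<Longrightarrow> \<not> inverted_by \<Gamma> a a"
  using inverted_by_distinct[of \<Gamma> a a] by argo

lemma inverted_by_asym:
  assumes \<Gamma>: "is_mixed_graph \<Gamma>" and ab: "inverted_by \<Gamma> a b"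
  shows "\<not> inverted_by \<Gamma> b a"
proof
  assume "inverted_by \<Gamma> b a"
  then have "origin \<Gamma> {a, b} = b"
    unfolding inverted_by_def insert_commute[of b a] by (elim conjE)
  moreover have "origin \<Gamma> {a, b} = a"
    using ab unfolding inverted_by_def by (elim conjE)
  ultimately show False
    using inverted_by_distinct[OF \<Gamma> ab] by argo
qed

lemma inverted_by_edge:
  assumes "is_mixed_graph \<Gamma>" "inverted_by \<Gamma> a b"
  shows "{a, b} \<in> edges \<Gamma>"
  using assms unfolding is_mixed_graph_def inverted_by_def by blast

lemma edge_in_verts:
  assumes "is_mixed_graph \<Gamma>" "{a, b} \<in> edges \<Gamma>"
  shows "Inl a \<in> letters (verts \<Gamma>)" "Inl b \<in> letters (verts \<Gamma>)"
proof -
  have "\<forall>e\<in>edges \<Gamma>. e \<subseteq> verts \<Gamma>"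
    using assms(1) unfolding is_mixed_graph_def by blast
  from bspec[OF this assms(2)] show "Inl a \<in> letters (verts \<Gamma>)" "Inl b \<in> letters (verts \<Gamma>)"
    by (auto simp: letters_def)
qed

lemma edge_cases:
  assumes "is_mixed_graph \<Gamma>" "{a, b} \<in> edges \<Gamma>"
  obtains "{a, b} \<notin> dir_edges \<Gamma>" | "inverted_by \<Gamma> a b" | "inverted_by \<Gamma> b a"
proof (cases "{a, b} \<in> dir_edges \<Gamma>")
  case True
  have ends: "\<forall>e\<in>dir_edges \<Gamma>. e = {origin \<Gamma> e, terminus \<Gamma> e}"
    using assms(1) unfolding is_mixed_graph_def by blast
  from iffD1[OF doubleton_eq_iff bspec[OF ends True]] show ?thesis
  proof
    assume "a = origin \<Gamma> {a, b} \<and> b = terminus \<Gamma> {a, b}"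
    then have "inverted_by \<Gamma> a b"
      unfolding inverted_by_def by (elim conjE) (intro conjI True, erule sym, erule sym)
    then show ?thesis
      by (rule that(2))
  next
    assume "a = terminus \<Gamma> {a, b} \<and> b = origin \<Gamma> {a, b}"
    then have "inverted_by \<Gamma> b a"
      unfolding inverted_by_def insert_commute[of b a]
      by (elim conjE) (intro conjI True, erule sym, erule sym)
    then show ?thesis
      by (rule that(3))
  qed
next
  case False
  then show ?thesis
    using that by blast
qed

lemma raag_exchange:
  assumes \<Gamma>: "is_mixed_graph \<Gamma>" and e: "{a, b} \<in> edges \<Gamma>"
  shows "([invert_if p (Inl a), invert_if q (Inl b)], [invert_if q (Inl b), invert_if p (Inl a)])
    \<in> pres_cong (verts \<Gamma>) (raag_rels (underlying_graph \<Gamma>))"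
proof -
  have "([Inl a, Inl b], [Inl b, Inl a])
      \<in> pres_cong (verts \<Gamma>) (raag_rels (underlying_graph \<Gamma>))"
    using e edge_in_verts[OF \<Gamma> e]
    by (intro pres_cong_rel) (auto simp: raag_rels_def underlying_graph_def)
  then show ?thesis
    using exchange_all_signs[OF edge_in_verts[OF \<Gamma> e], of False] by (simp add: invert_if_def[of False])
qed

lemma traag_exchange_directed:
  assumes \<Gamma>: "is_mixed_graph \<Gamma>" and ab: "inverted_by \<Gamma> a b"
  shows "([invert_if p (Inl a), invert_if q (Inl b)], [invert_if q (Inl b), invert_if (\<not> p) (Inl a)])
    \<in> pres_cong (verts \<Gamma>) (traag_rels \<Gamma>)"
proof -
  have e: "{a, b} \<in> edges \<Gamma>"
    by (rule inverted_by_edge[OF \<Gamma> ab])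
  note L = edge_in_verts[OF \<Gamma> e]
  let ?C = "pres_cong (verts \<Gamma>) (traag_rels \<Gamma>)"
  have "([Inl a, Inl b, Inl a], [Inl b]) \<in> ?C"
    using ab L by (intro pres_cong_rel) (auto simp: traag_rels_def inverted_by_def)
  from pres_cong_context[OF this, of "[]" "[inv_letter (Inl a)]"]
  have "([Inl a, Inl b, Inl a, inv_letter (Inl a)], [Inl b, inv_letter (Inl a)]) \<in> ?C"
    using L by simp
  moreover have "([Inl a, Inl b], [Inl a, Inl b, Inl a, inv_letter (Inl a)]) \<in> ?C"
    using pres_cong_sym[OF pres_cong_cancel_context(1)[of "Inl a" _ "[Inl a, Inl b]" "[]"]] L by simp
  ultimately have "([Inl a, Inl b], [Inl b, invert_if True (Inl a)]) \<in> ?C"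
    unfolding invert_if_def by (simp, meson pres_cong_trans)
  then show ?thesis
    using exchange_all_signs[OF L, of True] by simp
qed

text \<open>At most one of the two letters is inverted, so all kinds of edges fit one formula.\<close>

lemma traag_exchange:
  assumes \<Gamma>: "is_mixed_graph \<Gamma>" and e: "{a, b} \<in> edges \<Gamma>"
  shows "([invert_if p (Inl a), invert_if (q \<noteq> inverted_by \<Gamma> b a) (Inl b)],
      [invert_if q (Inl b), invert_if (p \<noteq> inverted_by \<Gamma> a b) (Inl a)])
    \<in> pres_cong (verts \<Gamma>) (traag_rels \<Gamma>)"
  using edge_cases[OF \<Gamma> e]
proof cases
  case 1
  then have "([Inl a, Inl b], [Inl b, Inl a]) \<in> pres_cong (verts \<Gamma>) (traag_rels \<Gamma>)"
    using e edge_in_verts[OF \<Gamma> e] by (intro pres_cong_rel) (auto simp: traag_rels_def)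
  moreover have "\<not> inverted_by \<Gamma> a b" "\<not> inverted_by \<Gamma> b a"
    using 1 by (auto simp: inverted_by_def insert_commute)
  ultimately show ?thesis
    using exchange_all_signs[OF edge_in_verts[OF \<Gamma> e], of False] by (simp add: invert_if_def[of False])
next
  case 2
  then show ?thesis
    using traag_exchange_directed[OF \<Gamma> 2] inverted_by_asym[OF \<Gamma> 2] by simp
next
  case 3
  then show ?thesis
    using pres_cong_sym[OF traag_exchange_directed[OF \<Gamma> 3, of q p]] inverted_by_asym[OF \<Gamma> 3] by simp
qed

lemma twist_traag_to_raag:
  assumes \<Gamma>: "is_mixed_graph \<Gamma>" and uv: "(u, v) \<in> pres_cong (verts \<Gamma>) (traag_rels \<Gamma>)"
  shows "(twist (inverted_by \<Gamma>) p u, twist (inverted_by \<Gamma>) p v)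
    \<in> pres_cong (verts \<Gamma>) (raag_rels (underlying_graph \<Gamma>))"
proof -
  let ?d = "inverted_by \<Gamma>"
  let ?C = "pres_cong (verts \<Gamma>) (raag_rels (underlying_graph \<Gamma>))"
  have rel: "(twist ?d p x, twist ?d p y) \<in> ?C \<and> parity_after ?d p x = parity_after ?d p y"
    if "(x, y) \<in> traag_rels \<Gamma>" for x y p
  proof -
    from that consider
      a b where "x = [Inl a, Inl b]" "y = [Inl b, Inl a]" "{a, b} \<in> edges \<Gamma>" "{a, b} \<notin> dir_edges \<Gamma>"
    | a b where "x = [Inl a, Inl b, Inl a]" "y = [Inl b]" "?d a b"
      unfolding traag_rels_def inverted_by_def by blast
    then show ?thesis
    proof cases
      case (1 a b)
      then have "\<not> ?d a b" "\<not> ?d b a"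
        by (auto simp: inverted_by_def insert_commute)
      then show ?thesis
        using 1 raag_exchange[OF \<Gamma> 1(3)] by (auto simp: fun_eq_iff)
    next
      case (2 a b)
      have e: "{a, b} \<in> edges \<Gamma>"
        by (rule inverted_by_edge[OF \<Gamma> 2(3)])
      note L = edge_in_verts[OF \<Gamma> e]
      let ?s = "invert_if (p a) (Inl a)" and ?t = "invert_if (p b) (Inl b)"
      \<comment> \<open>The second \<open>a\<close> sees one more \<open>b\<close> than the first, so the two get opposite exponents.\<close>
      have "twist ?d p x = [?s, ?t, inv_letter ?s]" "twist ?d p y = [?t]"
        using 2 inverted_by_irrefl[OF \<Gamma>] inverted_by_asym[OF \<Gamma> 2(3)]
        by (simp_all add: inv_invert_if)
      moreover have "([?s, ?t, inv_letter ?s], [?t, ?s, inv_letter ?s]) \<in> ?C"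
        using pres_cong_context[OF raag_exchange[OF \<Gamma> e], of "[]" "[inv_letter ?s]"] L by simp
      moreover have "([?t, ?s, inv_letter ?s], [?t]) \<in> ?C"
        using pres_cong_cancel_context(1)[of ?s _ "[?t]" "[]"] L by simp
      moreover have "parity_after ?d p x = parity_after ?d p y"
        using 2 by (auto simp: fun_eq_iff)
      ultimately show ?thesis
        by (metis pres_cong_trans)
    qed
  qed
  show ?thesis
    by (rule conjunct1, rule twist_pres_cong[where d = ?d])
      (rule inverted_by_irrefl[OF \<Gamma>], erule rel, rule uv)
qed

lemma twist_raag_to_traag:
  assumes \<Gamma>: "is_mixed_graph \<Gamma>"
    and uv: "(u, v) \<in> pres_cong (verts \<Gamma>) (raag_rels (underlying_graph \<Gamma>))"
  shows "(twist (inverted_by \<Gamma>) p u, twist (inverted_by \<Gamma>) p v)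
    \<in> pres_cong (verts \<Gamma>) (traag_rels \<Gamma>)"
proof -
  let ?d = "inverted_by \<Gamma>"
  have rel: "(twist ?d p x, twist ?d p y) \<in> pres_cong (verts \<Gamma>) (traag_rels \<Gamma>)
      \<and> parity_after ?d p x = parity_after ?d p y"
    if "(x, y) \<in> raag_rels (underlying_graph \<Gamma>)" for x y p
  proof -
    from that obtain a b where "x = [Inl a, Inl b]" "y = [Inl b, Inl a]" and e: "{a, b} \<in> edges \<Gamma>"
      unfolding raag_rels_def underlying_graph_def by auto
    then show ?thesis
      using traag_exchange[OF \<Gamma> e, of "p a" "p b"] by (auto simp: fun_eq_iff)
  qed
  show ?thesis
    by (rule conjunct1, rule twist_pres_cong[where d = ?d])
      (rule inverted_by_irrefl[OF \<Gamma>], erule rel, rule uv)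
qed

theorem theorem5p12:
  fixes \<Gamma> :: "'a mixed_graph"
  assumes "is_mixed_graph \<Gamma>"
  shows "spherical_growth (traag \<Gamma>) (letters (verts \<Gamma>)) (traag_letter \<Gamma>)
         = spherical_growth (raag (underlying_graph \<Gamma>)) (letters (verts \<Gamma>))
             (raag_letter (underlying_graph \<Gamma>))
       \<and> geodesic_growth (traag \<Gamma>) (letters (verts \<Gamma>)) (traag_letter \<Gamma>)
         = geodesic_growth (raag (underlying_graph \<Gamma>)) (letters (verts \<Gamma>))
             (raag_letter (underlying_graph \<Gamma>))"
proof -
  let ?L = "letters (verts \<Gamma>)" and ?X = "verts \<Gamma>"
  let ?T = "traag_rels \<Gamma>" and ?A = "raag_rels (underlying_graph \<Gamma>)"
  have V: "verts (underlying_graph \<Gamma>) = verts \<Gamma>"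
    by (simp add: underlying_graph_def)
  define f where "f = twist (inverted_by \<Gamma>) (\<lambda>_. False)"
  have f_in: "f w \<in> lists ?L" if "w \<in> lists ?L" for w
    unfolding f_def using that by (rule twist_in_lists)
  have ff: "f (f w) = w" for w
    by (simp add: f_def)
  have bij: "bij_betw f (lists ?L) (lists ?L)"
    by (rule bij_betw_byWitness[where f' = f]) (use f_in ff in blast)+
  have len: "length (f w) = length w" for w
    by (simp add: f_def)
  have cong: "(f u, f v) \<in> pres_cong ?X ?A \<longleftrightarrow> (u, v) \<in> pres_cong ?X ?T" for u v
    using twist_traag_to_raag[OF assms, of u v] twist_raag_to_traag[OF assms, of "f u" "f v"] ff
    unfolding f_def by metis
  have eq: "eval_word (presented_group ?X ?A) (letter_class ?X ?A) (f u)
        = eval_word (presented_group ?X ?A) (letter_class ?X ?A) (f v)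
      \<longleftrightarrow> eval_word (presented_group ?X ?T) (letter_class ?X ?T) u
        = eval_word (presented_group ?X ?T) (letter_class ?X ?T) v"
    if "u \<in> lists ?L" "v \<in> lists ?L" for u v
    using that f_in cong by (simp only: eval_word_presented_group pres_class_eq_iff)
  show ?thesis
    unfolding traag_def raag_def traag_letter_def raag_letter_def V
    using growth_eq_of_word_bijection[OF bij len eq presented_group_generated
        presented_group_generated]
    by blast
qed

end
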